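(* Let $\mathbb{F}$ be a field with $\mathrm{char}(\mathbb{F})\neq 2,3$ and let $n\geq 1$. Then all Jordan central extensions of $\mu_0^n$ are trivial; that is, every non-split central extension of $\mu_0^n$ (by a nonzero vector space) in the variety of Jordan algebras is isomorphic to $\mu_0^{n+1}$.
   Context: Algebras are over $\mathbb{F}$ and not necessarily associative. $\mu_0^n$ is the $n$-dimensional (associative, commutative) null-filiform algebra with basis $e_1,\dots,e_n$ and product $e_ie_j=e_{i+j}$, where $e_m=0$ for $m>n$. An algebra is Jordan if it is commutative and satisfies $x^2(yx)=(x^2y)x$ for all $x,y$. $\mathrm{Ann}(A)=\{x\in A: xA+Ax=0\}$. A central extension of an algebra $A$ by a vector space $V$ in a variety is an algebra of that variety of the form $A_\theta=A\oplus V$ with product $[x+v,y+w]_\theta=xy+\theta(x,y)$ for some bilinear map $\theta:A\times A\to V$. A central extension $E$ is non-split if there is no nonzero subspace $I\subseteq\mathrm{Ann}(E)$ such that $E=E_0\oplus I$ for some ideal $E_0$ of $E$. The central extension $\mu_0^{n+1}$ of $\mu_0^n$ is called trivial. *)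

theory Defs
  imports
    "HOL-Library.Function_Algebras"
    "HOL-Library.Product_Plus"
    "HOL-Computational_Algebra.Computational_Algebra"
begin

section \<open>Non-associative algebras\<close>

text \<open>
  Addition is taken from the ambient type. The algebra itself is the subspace \<open>carrier A\<close>, so
  that algebras whose dimension is a variable natural number can be handled; the values of
  \<open>amult A\<close> outside the carrier are irrelevant.
\<close>

record ('f, 'a) algebra =
  carrier :: "'a set"
  scale :: "'f \<Rightarrow> 'a \<Rightarrow> 'a"
  amult :: "'a \<Rightarrow> 'a \<Rightarrow> 'a"

definition bilinear_on ::
  "'a set \<Rightarrow> ('f \<Rightarrow> 'a \<Rightarrow> 'a) \<Rightarrow> ('f \<Rightarrow> 'b \<Rightarrow> 'b) \<Rightarrow> ('a::plus \<Rightarrow> 'a \<Rightarrow> 'b::plus) \<Rightarrow> bool" where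
  "bilinear_on S s t f \<longleftrightarrow>
     (\<forall>x\<in>S. \<forall>y\<in>S. \<forall>z\<in>S. f (x + y) z = f x z + f y z \<and> f z (x + y) = f z x + f z y) \<and>
     (\<forall>c. \<forall>x\<in>S. \<forall>y\<in>S. f (s c x) y = t c (f x y) \<and> f x (s c y) = t c (f x y))"

locale nonassoc_algebra = vector_space "scale A"
  for A :: "('f::field, 'a::ab_group_add) algebra" +
  assumes subspace_carrier: "subspace (carrier A)"
    and mult_closed: "\<lbrakk>x \<in> carrier A; y \<in> carrier A\<rbrakk> \<Longrightarrow> amult A x y \<in> carrier A"
    and mult_bilinear: "bilinear_on (carrier A) (scale A) (scale A) (amult A)"

definition jordan_algebra :: "('f::field, 'a::ab_group_add) algebra \<Rightarrow> bool" where
  "jordan_algebra A \<longleftrightarrow>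
     nonassoc_algebra A \<and>
     (\<forall>x\<in>carrier A. \<forall>y\<in>carrier A. amult A x y = amult A y x) \<and>
     (\<forall>x\<in>carrier A. \<forall>y\<in>carrier A.
        amult A (amult A x x) (amult A y x) = amult A (amult A (amult A x x) y) x)"

definition annihilator :: "('f, 'a::zero) algebra \<Rightarrow> 'a set" where
  "annihilator A = {x \<in> carrier A. \<forall>y\<in>carrier A. amult A x y = 0 \<and> amult A y x = 0}"

definition alg_ideal :: "('f::field, 'a::ab_group_add) algebra \<Rightarrow> 'a set \<Rightarrow> bool" where
  "alg_ideal A J \<longleftrightarrow>
     module.subspace (scale A) J \<and> J \<subseteq> carrier A \<and>
     (\<forall>x\<in>carrier A. \<forall>y\<in>J. amult A x y \<in> J \<and> amult A y x \<in> J)"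

definition direct_sum_of :: "'a::ab_group_add set \<Rightarrow> 'a set \<Rightarrow> 'a set \<Rightarrow> bool" where
  "direct_sum_of S U W \<longleftrightarrow> S = {u + w | u w. u \<in> U \<and> w \<in> W} \<and> U \<inter> W = {0}"

definition non_split :: "('f::field, 'a::ab_group_add) algebra \<Rightarrow> bool" where
  "non_split E \<longleftrightarrow>
     \<not> (\<exists>I E0. module.subspace (scale E) I \<and> I \<noteq> {0} \<and> I \<subseteq> annihilator E \<and>
              alg_ideal E E0 \<and> direct_sum_of (carrier E) E0 I)"

definition alg_isomorphic ::
  "('f, 'a::plus) algebra \<Rightarrow> ('f, 'b::plus) algebra \<Rightarrow> bool" where
  "alg_isomorphic A B \<longleftrightarrow>
     (\<exists>\<phi>. bij_betw \<phi> (carrier A) (carrier B) \<and>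
          (\<forall>x\<in>carrier A. \<forall>y\<in>carrier A. \<phi> (x + y) = \<phi> x + \<phi> y) \<and>
          (\<forall>c. \<forall>x\<in>carrier A. \<phi> (scale A c x) = scale B c (\<phi> x)) \<and>
          (\<forall>x\<in>carrier A. \<forall>y\<in>carrier A. \<phi> (amult A x y) = amult B (\<phi> x) (\<phi> y)))"


section \<open>Central extensions\<close>

text \<open>The vector space \<open>V\<close> is the whole type \<open>'v\<close> with scalar multiplication \<open>s\<close>.\<close>

definition extension_by ::
  "('f, 'a::plus) algebra \<Rightarrow> ('f \<Rightarrow> 'v \<Rightarrow> 'v) \<Rightarrow> ('a \<Rightarrow> 'a \<Rightarrow> 'v::plus) \<Rightarrow> ('f, 'a \<times> 'v) algebra" where
  "extension_by A s \<theta> =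
     \<lparr>carrier = carrier A \<times> UNIV,
      scale = (\<lambda>c (x, v). (scale A c x, s c v)),
      amult = (\<lambda>(x, v) (y, w). (amult A x y, \<theta> x y))\<rparr>"

text \<open>The variety is given by its membership predicate \<open>P\<close>.\<close>

definition central_extension_in ::
  "(('f, 'a \<times> 'v) algebra \<Rightarrow> bool) \<Rightarrow>
   ('f::field, 'a::ab_group_add) algebra \<Rightarrow> ('f \<Rightarrow> 'v \<Rightarrow> 'v::ab_group_add) \<Rightarrow>
   ('f, 'a \<times> 'v) algebra \<Rightarrow> bool" where
  "central_extension_in P A s E \<longleftrightarrow>
     (\<exists>\<theta>. bilinear_on (carrier A) (scale A) s \<theta> \<and> E = extension_by A s \<theta>) \<and> P E"

lemma nonassoc_algebra_extension_by:
  assumes "nonassoc_algebra A" "vector_space s" "bilinear_on (carrier A) (scale A) s \<theta>"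
  shows "nonassoc_algebra (extension_by A s \<theta>)"
proof -
  interpret A: nonassoc_algebra A by fact
  interpret s: vector_space s by fact
  interpret E: vector_space "scale (extension_by A s \<theta>)"
    by unfold_locales
      (auto simp: extension_by_def A.scale_right_distrib A.scale_left_distrib
        s.scale_right_distrib s.scale_left_distrib)
  show ?thesis
  proof
    show "E.subspace (carrier (extension_by A s \<theta>))"
      using A.subspace_carrier unfolding E.subspace_def A.subspace_def
      by (auto simp: extension_by_def zero_prod_def)
  qed (use A.mult_closed A.mult_bilinear assms(3) in
      \<open>auto simp: extension_by_def bilinear_on_def\<close>)
qed


section \<open>The null-filiform algebra\<close>

text \<open>
  Vectors are coordinate functions supported on \<open>{1..n}\<close>. The vector \<open>nf_basis n i\<close> is $e_i$ for
  \<open>1 \<le> i \<le> n\<close> and zero for every other index; the product is the bilinear extension of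
  $e_i e_j = e_{i+j}$.
\<close>

definition nf_basis :: "nat \<Rightarrow> nat \<Rightarrow> (nat \<Rightarrow> 'f::field)" where
  "nf_basis n i = (\<lambda>k. if 1 \<le> i \<and> i \<le> n \<and> k = i then 1 else 0)"

definition null_filiform :: "nat \<Rightarrow> ('f::field, nat \<Rightarrow> 'f) algebra" where
  "null_filiform n =
     \<lparr>carrier = {x. \<forall>i. i \<notin> {1..n} \<longrightarrow> x i = 0},
      scale = (\<lambda>c x k. c * x k),
      amult = (\<lambda>x y k. \<Sum>i\<in>{1..n}. \<Sum>j\<in>{1..n}. x i * y j * nf_basis n (i + j) k)\<rparr>"

lemma nonassoc_algebra_null_filiform:
  "nonassoc_algebra (null_filiform n :: ('f::field, nat \<Rightarrow> 'f) algebra)"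
proof -
  interpret vector_space "scale (null_filiform n :: ('f::field, nat \<Rightarrow> 'f) algebra)"
    by unfold_locales (auto simp: null_filiform_def fun_eq_iff algebra_simps)
  show ?thesis
  proof
    show "subspace (carrier (null_filiform n :: ('f, nat \<Rightarrow> 'f) algebra))"
      unfolding subspace_def by (auto simp: null_filiform_def)
    show "bilinear_on (carrier (null_filiform n)) (scale (null_filiform n))
        (scale (null_filiform n)) (amult (null_filiform n :: ('f, nat \<Rightarrow> 'f) algebra))"
      unfolding bilinear_on_def null_filiform_def
      by (simp add: fun_eq_iff distrib_left distrib_right sum.distrib sum_distrib_left mult_ac)
  qed (auto simp: null_filiform_def nf_basis_def intro!: sum.neutral)
qed

lemma amult_nf_basis:
  assumes "i \<in> {1..n}" "j \<in> {1..n}"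
  shows "amult (null_filiform n) (nf_basis n i) (nf_basis n j) = nf_basis n (i + j)"
proof
  fix k
  have e: "nf_basis n i i' = (if i' = i then 1 else 0 :: 'a)"
    "nf_basis n j i' = (if i' = j then 1 else 0 :: 'a)" for i'
    using assms by (auto simp: nf_basis_def)
  have "amult (null_filiform n) (nf_basis n i) (nf_basis n j :: nat \<Rightarrow> 'a) k =
    (\<Sum>i'\<in>{1..n}. \<Sum>j'\<in>{1..n}.
      if j' = j then (if i' = i then nf_basis n (i' + j') k else 0) else 0)"
    unfolding null_filiform_def algebra.simps by (intro sum.cong refl) (simp add: e)
  then show "amult (null_filiform n) (nf_basis n i) (nf_basis n j :: nat \<Rightarrow> 'a) k =
    nf_basis n (i + j) k"
    using assms by simp
qed

end

theory Submission
  imports Defs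
begin

text \<open>
  Write $\theta_{ij} = \theta(e_i, e_j)$, with $e_m = 0$ for \<open>m = 0\<close> and \<open>m > n\<close>. The whole matter
  is that a Jordan algebra of characteristic different from \<open>2\<close> and \<open>3\<close> is power-associative: in the extension
  \<open>E\<close> the powers of \<open>a = (e\<^sub>1, 0)\<close> are $a^k = (e_k, \theta_{k-1,1})$, and $a^i a^j = a^{i+j}$ says
  exactly that $\theta_{ij} = \theta_{i+j-1,1}$. Only this instance of power-associativity is needed,
  and it follows from the part of the Jordan identity that is linear in one variable
  (\<open>cocycle_jordan_linearized\<close>): evaluated at $x = e_1$, $z = e_c$ and $y = e_d$ it is the recurrence
  $$\theta_{2,c+d} + 2\theta_{c+1,d+1} = \theta_{d+2,c} + 2\theta_{c+d+1,1}.$$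
  For \<open>c = 1\<close> it gives $3\theta_{2,d+1} = 3\theta_{d+2,1}$. This reduces it to
  $2\theta_{c+1,d+1} = \theta_{c,d+2} + \theta_{c+d+1,1}$, from which induction on \<open>c\<close> and division by
  \<open>2\<close> give the claim (\<open>hankel_from_jordan_recurrence\<close>).

  So $\theta_{ij} = g_{i+j}$ with $g_k = \theta_{k-1,1}$, and $g_k = 0$ as soon as \<open>k > n + 1\<close>. The
  values $g_k$ with \<open>k \<le> n\<close> are a coboundary: they are the linear map $e_k \mapsto g_k$ applied to the
  product in $\mu_0^n$. What is left is the single vector $g_{n+1}$, multiplied by the coefficient
  of $e_{n+1}$ in the product formed in $\mu_0^{n+1}$ (\<open>cocycle_decomposition\<close>). A complement of the
  span of $g_{n+1}$ in \<open>V\<close> would split off from \<open>E\<close>, so that for non-split \<open>E\<close> the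
  vector $g_{n+1}$ spans \<open>V\<close> (\<open>non_split_imp_spanned\<close>). As \<open>V\<close> is nonzero, it is a line, and \<open>E\<close> has
  the basis $a, a^2, \dots, a^{n+1}$, which multiplies as the basis of $\mu_0^{n+1}$ does.
\<close>

section \<open>Linear algebra\<close>

lemma sum_of_functions_apply: "(\<Sum>i\<in>I. h i) k = (\<Sum>i\<in>I. h i k)"
  for h :: "'i \<Rightarrow> 'a \<Rightarrow> 'b::comm_monoid_add"
  by (induction I rule: infinite_finite_induct) auto

lemma linear_on_subspace_sum:
  assumes "vector_space t" "vector_space s" "module.subspace t S"
    and add: "\<And>x y. x \<in> S \<Longrightarrow> y \<in> S \<Longrightarrow> f (x + y) = f x + f y"
    and scale: "\<And>c x. x \<in> S \<Longrightarrow> f (t c x) = s c (f x)"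
    and e: "\<And>i. i \<in> I \<Longrightarrow> e i \<in> S"
  shows "f (\<Sum>i\<in>I. t (c i) (e i)) = (\<Sum>i\<in>I. s (c i) (f (e i)))"
proof -
  interpret t: vector_space t by fact
  interpret s: vector_space s by fact
  have zero: "f 0 = 0"
    using scale[of 0 0] t.subspace_0[OF assms(3)] by simp
  have S: "(\<Sum>i\<in>J. t (c i) (e i)) \<in> S" if "J \<subseteq> I" for J
    using that e by (intro t.subspace_sum[OF assms(3)] t.subspace_scale[OF assms(3)]) auto
  from e S show ?thesis
    by (induction I rule: infinite_finite_induct)
      (auto simp: zero add scale t.subspace_scale[OF assms(3)] subset_insertI)
qed

lemma (in vector_space) projection_onto_subspace_exists:
  assumes "subspace U"
  obtains p where "Vector_Spaces.linear scale scale p" "range p \<subseteq> U" "\<And>u. u \<in> U \<Longrightarrow> p u = u"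
proof -
  interpret vector_space_pair scale scale ..
  obtain p where "range p \<subseteq> U" "Vector_Spaces.linear scale scale p" "\<And>u. u \<in> U \<Longrightarrow> p u = u"
    using linear_exists_left_inverse_on[OF linear_ident assms] by auto
  then show ?thesis using that by blast
qed

lemma (in vector_space) prime_torsion_free:
  fixes v :: 'b
  assumes "prime p" "CHAR('a) \<noteq> p" and "scale (of_nat p) v = 0"
  shows "v = 0"
proof -
  have "\<not> CHAR('a) dvd p"
    using assms(1,2) by (metis CHAR_not_1' One_nat_def prime_nat_iff)
  then have "of_nat p \<noteq> (0::'a)"
    by (simp add: of_nat_eq_0_iff_char_dvd)
  then show ?thesis using assms(3) by (simp only: scale_eq_0_iff) simp
qed

lemma (in vector_space) two_torsion_free:
  fixes v :: 'b
  assumes "CHAR('a) \<noteq> 2" and "v + v = 0"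
  shows "v = 0"
  using prime_torsion_free[of 2 v] assms scale_left_distrib[of 1 1 v] by simp

lemma (in vector_space) three_torsion_free:
  fixes v :: 'b
  assumes "CHAR('a) \<noteq> 3" and "v + v + v = 0"
  shows "v = 0"
  using prime_torsion_free[of 3 v] assms scale_left_distrib[of 2 1 v] scale_left_distrib[of 1 1 v]
  by simp


section \<open>From the Jordan identity to a Hankel condition\<close>

text \<open>
  Polarization of a cubic identity. The identity at \<open>x + z\<close> and at \<open>x + 2z\<close> gives two relations
  between its parts of degrees \<open>1\<close> and \<open>2\<close> in \<open>z\<close>, from which both parts can be solved for after
  division by \<open>2\<close>. No scalars are involved, so small fields cause no trouble.
\<close>

lemma linearize_trilinear_identity:
  fixes T :: "'a::ab_semigroup_add \<Rightarrow> 'a \<Rightarrow> 'a \<Rightarrow> 'b::ab_group_add"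
  assumes closed: "\<And>x y. x \<in> S \<Longrightarrow> y \<in> S \<Longrightarrow> x + y \<in> S"
    and add1: "\<And>x x' y z. x \<in> S \<Longrightarrow> x' \<in> S \<Longrightarrow> y \<in> S \<Longrightarrow> z \<in> S \<Longrightarrow> T (x + x') y z = T x y z + T x' y z"
    and add2: "\<And>x x' y z. x \<in> S \<Longrightarrow> x' \<in> S \<Longrightarrow> y \<in> S \<Longrightarrow> z \<in> S \<Longrightarrow> T y (x + x') z = T y x z + T y x' z"
    and add3: "\<And>x x' y z. x \<in> S \<Longrightarrow> x' \<in> S \<Longrightarrow> y \<in> S \<Longrightarrow> z \<in> S \<Longrightarrow> T y z (x + x') = T y z x + T y z x'"
    and vanish: "\<And>x. x \<in> S \<Longrightarrow> T x x x = 0"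
    and torsion: "\<And>v::'b. v + v = 0 \<Longrightarrow> v = 0"
    and S: "x \<in> S" "z \<in> S"
  shows "T x x z + T x z x + T z x x = 0"
proof -
  define J1 where "J1 = T x x z + T x z x + T z x x"
  define J2 where "J2 = T x z z + T z x z + T z z x"
  have one: "J1 + J2 = 0"
    using vanish[OF closed[OF S]] vanish[OF S(1)] vanish[OF S(2)]
    unfolding J1_def J2_def by (simp add: add1 add2 add3 S closed algebra_simps)
  have two: "(J1 + J2) + (J1 + J2) + (J2 + J2) = 0"
    using vanish[OF closed[OF S(1) closed[OF S(2) S(2)]]] vanish[OF S(1)] vanish[OF S(2)]
    unfolding J1_def J2_def by (simp add: add1 add2 add3 S closed algebra_simps)
  have "J2 = 0" using one two torsion[of J2] by simp
  then show ?thesis using one by (simp add: J1_def)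
qed

text \<open>
  Power-associativity in coordinates: a symmetric matrix that satisfies the linearized Jordan
  identity depends only on the sum of its indices. Row \<open>1\<close> is symmetry. Row \<open>2\<close> is the case \<open>c = 1\<close>
  of the recurrence, where a factor \<open>3\<close> appears; it determines one term of the general case, which
  then carries row \<open>c\<close> to row \<open>c + 1\<close> up to a factor \<open>2\<close>.
\<close>

lemma hankel_from_jordan_recurrence:
  fixes f :: "nat \<Rightarrow> nat \<Rightarrow> 'v::ab_group_add"
  assumes sym: "\<And>i j. f i j = f j i"
    and rec: "\<And>c d. c \<ge> 1 \<Longrightarrow> d \<ge> 1 \<Longrightarrow>
      f 2 (c + d) + f (c + 1) (d + 1) + f (c + 1) (d + 1) =
      f (d + 2) c + f (c + d + 1) 1 + f (c + d + 1) 1"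
    and torsion2: "\<And>v::'v. v + v = 0 \<Longrightarrow> v = 0"
    and torsion3: "\<And>v::'v. v + v + v = 0 \<Longrightarrow> v = 0"
    and "i \<ge> 1" "j \<ge> 1"
  shows "f i j = f (i + j - 1) 1"
proof -
  have two: "f 2 m = f (m + 1) 1" if m: "m \<ge> 1" for m
  proof (cases "m = 1")
    case False
    then obtain d where d: "m = d + 1" "d \<ge> 1" using m by (cases m) auto
    have "f 2 m - f (m + 1) 1 = 0"
      by (rule torsion3) (use rec[of 1 d] d in \<open>simp add: algebra_simps numeral_2_eq_2\<close>)
    then show ?thesis by simp
  qed (simp add: numeral_2_eq_2)
  show ?thesis using \<open>i \<ge> 1\<close> \<open>j \<ge> 1\<close>
  proof (induction i arbitrary: j rule: dec_induct)
    case base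
    then show ?case using sym[of 1 j] by simp
  next
    case (step c)
    show ?case
    proof (cases "j = 1")
      case False
      then obtain d where d: "j = d + 1" "d \<ge> 1" using step by (cases j) auto
      have "f (d + 2) c = f (c + d + 1) 1"
        using step.IH[of "d + 2"] sym[of c] by simp
      moreover have "f 2 (c + d) = f (c + d + 1) 1"
        using two[of "c + d"] step by simp
      ultimately have "f (c + 1) (d + 1) + f (c + 1) (d + 1) = f (c + d + 1) 1 + f (c + d + 1) 1"
        using rec[of c d] d step by (simp add: add.assoc)
      then have "f (c + 1) (d + 1) - f (c + d + 1) 1 = 0"
        by (intro torsion2[of "_ - _"]) (simp add: algebra_simps)
      then show ?thesis using d by simp
    qed simp
  qed
qed


section \<open>Coordinates in the null-filiform algebra\<close>

lemma nf_basis_in_carrier: "nf_basis n i \<in> carrier (null_filiform n)"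
  by (auto simp: nf_basis_def null_filiform_def)

lemma null_filiform_expand:
  assumes "x \<in> carrier (null_filiform n)"
  shows "x = (\<Sum>i\<in>{1..n}. scale (null_filiform n) (x i) (nf_basis n i))"
proof
  fix k
  have "(\<Sum>i\<in>{1..n}. x i * nf_basis n i k) = (\<Sum>i\<in>{1..n}. if i = k then x i else 0)"
    by (intro sum.cong) (auto simp: nf_basis_def)
  then show "x k = (\<Sum>i\<in>{1..n}. scale (null_filiform n) (x i) (nf_basis n i)) k"
    using assms by (auto simp: sum_of_functions_apply null_filiform_def)
qed

lemma amult_nf_basis_pos:
  assumes "i \<ge> 1" "j \<ge> 1"
  shows "amult (null_filiform n) (nf_basis n i) (nf_basis n j) = nf_basis n (i + j)"
proof (cases "i \<le> n \<and> j \<le> n")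
  case True
  then show ?thesis using assms by (simp add: amult_nf_basis)
next
  case False
  then show ?thesis by (auto simp: null_filiform_def nf_basis_def fun_eq_iff)
qed

lemma amult_null_filiform_outside:
  assumes "k \<notin> {1..n}"
  shows "amult (null_filiform n) x y k = 0"
  using assms by (auto simp: null_filiform_def nf_basis_def intro!: sum.neutral)

text \<open>
  The coordinates in degree at most \<open>n + 1\<close> of a product in $\mu_0^{n+1}$ involve only the
  coordinates of the factors in degrees \<open>1, \<dots>, n\<close>, because every basis vector has positive
  degree. Hence the factors may be changed in degree \<open>n + 1\<close>; the number obtained for
  \<open>k = n + 1\<close> is a bilinear form on $\mu_0^n$.
\<close>

lemma amult_null_filiform_coord:
  assumes "k \<in> {1..n + 1}"
    and "\<And>i. i \<in> {1..n} \<Longrightarrow> x' i = x i" "\<And>i. i \<in> {1..n} \<Longrightarrow> y' i = y i"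
  shows "amult (null_filiform (n + 1)) x' y' k =
    (\<Sum>i\<in>{1..n}. \<Sum>j\<in>{1..n}. x i * y j * (if i + j = k then 1 else 0))"
proof -
  have "amult (null_filiform (n + 1)) x' y' k =
    (\<Sum>i\<in>{1..n + 1}. \<Sum>j\<in>{1..n + 1}. x' i * y' j * (if i + j = k then 1 else 0))"
    unfolding null_filiform_def algebra.simps
    using assms(1) by (intro sum.cong refl) (auto simp: nf_basis_def)
  also have "\<dots> = (\<Sum>i\<in>{1..n}. \<Sum>j\<in>{1..n + 1}. x' i * y' j * (if i + j = k then 1 else 0))"
    using assms(1) by (intro sum.mono_neutral_right) (auto intro!: sum.neutral)
  also have "\<dots> = (\<Sum>i\<in>{1..n}. \<Sum>j\<in>{1..n}. x' i * y' j * (if i + j = k then 1 else 0))"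
    using assms(1) by (intro sum.cong refl sum.mono_neutral_right) auto
  finally show ?thesis using assms by simp
qed

lemma amult_null_filiform_truncate:
  assumes "k \<in> {1..n}"
    and "\<And>i. i \<in> {1..n} \<Longrightarrow> x' i = x i" "\<And>i. i \<in> {1..n} \<Longrightarrow> y' i = y i"
  shows "amult (null_filiform (n + 1)) x' y' k = amult (null_filiform n) x y k"
proof -
  have "amult (null_filiform n) x y k =
    (\<Sum>i\<in>{1..n}. \<Sum>j\<in>{1..n}. x i * y j * (if i + j = k then 1 else 0))"
    unfolding null_filiform_def algebra.simps
    using assms(1) by (intro sum.cong refl) (auto simp: nf_basis_def)
  then show ?thesis using amult_null_filiform_coord[of k n x' x y' y] assms by simp
qed


section \<open>Jordan cocycles on the null-filiform algebra\<close>

text \<open>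
  A cocycle is considered together with the Jordan property of the extension that it defines; the
  identities for \<open>\<theta>\<close> are the second components of those of the extension.
\<close>

locale nf_jordan_cocycle = V: vector_space s
  for s :: "'f::field \<Rightarrow> 'v::ab_group_add \<Rightarrow> 'v" +
  fixes n :: nat and \<theta> :: "(nat \<Rightarrow> 'f) \<Rightarrow> (nat \<Rightarrow> 'f) \<Rightarrow> 'v"
  assumes char2: "CHAR('f) \<noteq> 2" and char3: "CHAR('f) \<noteq> 3"
    and bilinear: "bilinear_on (carrier (null_filiform n)) (scale (null_filiform n)) s \<theta>"
    and jordan: "jordan_algebra (extension_by (null_filiform n) s \<theta>)"
begin

abbreviation M :: "('f, nat \<Rightarrow> 'f) algebra" where "M \<equiv> null_filiform n"

abbreviation E :: "('f, (nat \<Rightarrow> 'f) \<times> 'v) algebra" where "E \<equiv> extension_by M s \<theta>"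

sublocale M: nonassoc_algebra "null_filiform n :: ('f, nat \<Rightarrow> 'f) algebra"
  by (rule nonassoc_algebra_null_filiform)

sublocale E: nonassoc_algebra "extension_by (null_filiform n) s \<theta>"
  using jordan by (simp add: jordan_algebra_def)

lemma cocycle_symmetric:
  assumes "x \<in> carrier M" "y \<in> carrier M"
  shows "\<theta> x y = \<theta> y x"
proof -
  have "\<forall>X\<in>carrier E. \<forall>Y\<in>carrier E. amult E X Y = amult E Y X"
    using jordan unfolding jordan_algebra_def by blast
  from this[rule_format, of "(x, 0)" "(y, 0)"] show ?thesis
    using assms by (simp add: extension_by_def)
qed

lemma cocycle_jordan:
  assumes "x \<in> carrier M" "y \<in> carrier M"
  shows "\<theta> (amult M x x) (amult M y x) = \<theta> (amult M (amult M x x) y) x"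
proof -
  have "\<forall>X\<in>carrier E. \<forall>Y\<in>carrier E.
      amult E (amult E X X) (amult E Y X) = amult E (amult E (amult E X X) Y) X"
    using jordan unfolding jordan_algebra_def by blast
  from this[rule_format, of "(x, 0)" "(y, 0)"] show ?thesis
    using assms by (simp add: extension_by_def)
qed

text \<open>
  For fixed \<open>y\<close>, the two sides of the Jordan identity differ by the diagonal of a trilinear map,
  \<open>T\<close> in the proof, so that polarization applies.
\<close>

lemma cocycle_jordan_linearized:
  assumes S: "x \<in> carrier M" "y \<in> carrier M" "z \<in> carrier M"
  shows "\<theta> (amult M x x) (amult M y z) + \<theta> (amult M x z) (amult M y x)
         + \<theta> (amult M z x) (amult M y x) =
         \<theta> (amult M (amult M x x) y) z + \<theta> (amult M (amult M x z) y) x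
         + \<theta> (amult M (amult M z x) y) x"
proof -
  define T where "T p q r = \<theta> (amult M p q) (amult M y r) - \<theta> (amult M (amult M p q) y) r" for p q r
  have \<theta>: "\<theta> (a + b) c = \<theta> a c + \<theta> b c" "\<theta> c (a + b) = \<theta> c a + \<theta> c b"
    if "a \<in> carrier M" "b \<in> carrier M" "c \<in> carrier M" for a b c
    using bilinear that unfolding bilinear_on_def by blast+
  have m: "amult M (a + b) c = amult M a c + amult M b c"
    "amult M c (a + b) = amult M c a + amult M c b"
    if "a \<in> carrier M" "b \<in> carrier M" "c \<in> carrier M" for a b c
    using M.mult_bilinear that unfolding bilinear_on_def by blast+
  note closed = M.mult_closed M.subspace_add[OF M.subspace_carrier] S
  have "T x x z + T x z x + T z x x = 0"
  proof (rule linearize_trilinear_identity[where S = "carrier M"])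
    show "T p p p = 0" if "p \<in> carrier M" for p
      using cocycle_jordan[OF that S(2)] by (simp add: T_def)
    show "v = 0" if "v + v = 0" for v :: 'v
      using that by (rule V.two_torsion_free[OF char2])
  qed (simp_all add: T_def \<theta> m closed algebra_simps del: plus_fun_apply)
  then show ?thesis by (simp add: T_def algebra_simps)
qed

lemma cocycle_hankel:
  assumes "i \<ge> 1" "j \<ge> 1"
  shows "\<theta> (nf_basis n i) (nf_basis n j) = \<theta> (nf_basis n (i + j - 1)) (nf_basis n 1)"
proof (rule hankel_from_jordan_recurrence[where f = "\<lambda>i j. \<theta> (nf_basis n i) (nf_basis n j)"])
  fix c d :: nat
  assume "c \<ge> 1" "d \<ge> 1"
  then show "\<theta> (nf_basis n 2) (nf_basis n (c + d)) + \<theta> (nf_basis n (c + 1)) (nf_basis n (d + 1)) +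
      \<theta> (nf_basis n (c + 1)) (nf_basis n (d + 1)) =
      \<theta> (nf_basis n (d + 2)) (nf_basis n c) + \<theta> (nf_basis n (c + d + 1)) (nf_basis n 1) +
      \<theta> (nf_basis n (c + d + 1)) (nf_basis n 1)"
    using cocycle_jordan_linearized[of "nf_basis n 1" "nf_basis n d" "nf_basis n c"]
    by (simp add: nf_basis_in_carrier amult_nf_basis_pos add_ac numeral_2_eq_2)
next
  show "\<theta> (nf_basis n i) (nf_basis n j) = \<theta> (nf_basis n j) (nf_basis n i)" for i j
    by (intro cocycle_symmetric nf_basis_in_carrier)
qed (use assms V.two_torsion_free[OF char2] V.three_torsion_free[OF char3] in blast)+

text \<open>
  This is the component in \<open>V\<close> of the \<open>k\<close>-th power of \<open>(e\<^sub>1, 0)\<close> in the extension. For \<open>k = 1\<close> the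
  vector \<open>nf_basis n 0\<close> is zero, as it should be.
\<close>

definition power_tail :: "nat \<Rightarrow> 'v" where
  "power_tail k = \<theta> (nf_basis n (k - 1)) (nf_basis n 1)"

text \<open>
  The graph of this map is the span of the first \<open>n\<close> powers of \<open>(e\<^sub>1, 0)\<close>.
\<close>

definition tail_map :: "(nat \<Rightarrow> 'f) \<Rightarrow> 'v" where
  "tail_map x = (\<Sum>k\<in>{1..n}. s (x k) (power_tail k))"

abbreviation top_coeff :: "(nat \<Rightarrow> 'f) \<Rightarrow> (nat \<Rightarrow> 'f) \<Rightarrow> 'f" where
  "top_coeff x y \<equiv> amult (null_filiform (n + 1)) x y (n + 1)"

lemma tail_map_add: "tail_map (x + y) = tail_map x + tail_map y"
  by (simp add: tail_map_def V.scale_left_distrib sum.distrib)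

lemma tail_map_scale: "tail_map (scale M c x) = s c (tail_map x)"
  by (simp add: tail_map_def V.scale_sum_right null_filiform_def)

lemma tail_map_zero: "tail_map 0 = 0"
  by (simp add: tail_map_def)

lemma cocycle_expand:
  assumes x: "x \<in> carrier M" and y: "y \<in> carrier M"
  shows "\<theta> x y = (\<Sum>i\<in>{1..n}. \<Sum>j\<in>{1..n}. s (x i * y j) (power_tail (i + j)))"
proof -
  have "\<theta> x y = \<theta> (\<Sum>i\<in>{1..n}. scale M (x i) (nf_basis n i)) y"
    using null_filiform_expand[OF x] by simp
  also have "\<dots> = (\<Sum>i\<in>{1..n}. s (x i) (\<theta> (nf_basis n i) y))"
    by (rule linear_on_subspace_sum[where f = "\<lambda>x. \<theta> x y",
          OF M.vector_space_axioms V.vector_space_axioms M.subspace_carrier])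
      (use bilinear y in \<open>auto simp: bilinear_on_def nf_basis_in_carrier\<close>)
  also have "\<dots> = (\<Sum>i\<in>{1..n}. s (x i) (\<Sum>j\<in>{1..n}. s (y j) (power_tail (i + j))))"
  proof (rule sum.cong)
    fix i assume i: "i \<in> {1..n}"
    have "\<theta> (nf_basis n i) y = \<theta> (nf_basis n i) (\<Sum>j\<in>{1..n}. scale M (y j) (nf_basis n j))"
      using null_filiform_expand[OF y] by simp
    also have "\<dots> = (\<Sum>j\<in>{1..n}. s (y j) (\<theta> (nf_basis n i) (nf_basis n j)))"
      by (rule linear_on_subspace_sum[where f = "\<lambda>y. \<theta> (nf_basis n i) y",
            OF M.vector_space_axioms V.vector_space_axioms M.subspace_carrier])
        (use bilinear in \<open>auto simp: bilinear_on_def nf_basis_in_carrier\<close>)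
    also have "\<dots> = (\<Sum>j\<in>{1..n}. s (y j) (power_tail (i + j)))"
      using i by (intro sum.cong refl) (simp add: power_tail_def cocycle_hankel)
    finally show "s (x i) (\<theta> (nf_basis n i) y) =
        s (x i) (\<Sum>j\<in>{1..n}. s (y j) (power_tail (i + j)))"
      by simp
  qed simp
  finally show ?thesis by (simp add: V.scale_sum_right)
qed

lemma power_tail_eq_zero: "power_tail k = 0" if "k > n + 1"
proof -
  have "nf_basis n (k - 1) = scale M 0 (nf_basis n (k - 1) :: nat \<Rightarrow> 'f)"
    using that by (auto simp: nf_basis_def null_filiform_def)
  then have "power_tail k = s 0 (power_tail k)"
    using bilinear nf_basis_in_carrier unfolding power_tail_def bilinear_on_def by metis
  then show ?thesis by simp
qed

text \<open>
  The first summand is the coboundary of \<open>tail_map\<close>. Subtracting it amounts to replacing the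
  complement \<open>carrier M \<times> {0}\<close> of \<open>V\<close> by the graph of \<open>tail_map\<close>, and the cocycle that remains has
  values in the span of \<open>power_tail (n + 1)\<close>. The proof sorts the expansion of \<open>\<theta> x y\<close> by degree.
\<close>

lemma cocycle_decomposition:
  assumes x: "x \<in> carrier M" and y: "y \<in> carrier M"
  shows "\<theta> x y = tail_map (amult M x y) + s (top_coeff x y) (power_tail (n + 1))"
proof -
  \<comment> \<open>Both sides vanish if \<open>i + j > n + 1\<close>, so the sum over degrees may stop at \<open>n + 1\<close>.\<close>
  have split: "power_tail (i + j) =
      (\<Sum>k\<in>{1..n + 1}. s (if i + j = k then 1 else 0) (power_tail k))"
    if "i \<ge> 1" "j \<ge> 1" for i j
  proof -
    have "(\<Sum>k\<in>{1..n + 1}. s (if i + j = k then 1 else 0) (power_tail k)) =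
        (\<Sum>k\<in>{1..n + 1}. if i + j = k then power_tail k else 0)"
      by (intro sum.cong) auto
    then show ?thesis using that power_tail_eq_zero[of "i + j"] by auto
  qed
  have "\<theta> x y = (\<Sum>i\<in>{1..n}. \<Sum>j\<in>{1..n}. \<Sum>k\<in>{1..n + 1}.
      s (x i * y j * (if i + j = k then 1 else 0)) (power_tail k))"
    unfolding cocycle_expand[OF x y]
    by (intro sum.cong refl, subst split) (auto simp: V.scale_sum_right simp del: sum.cl_ivl_Suc)
  also have "\<dots> = (\<Sum>i\<in>{1..n}. \<Sum>k\<in>{1..n + 1}. \<Sum>j\<in>{1..n}.
      s (x i * y j * (if i + j = k then 1 else 0)) (power_tail k))"
    by (intro sum.cong refl sum.swap)
  also have "\<dots> = (\<Sum>k\<in>{1..n + 1}. \<Sum>i\<in>{1..n}. \<Sum>j\<in>{1..n}.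
      s (x i * y j * (if i + j = k then 1 else 0)) (power_tail k))"
    by (rule sum.swap)
  also have "\<dots> = (\<Sum>k\<in>{1..n + 1}. s (amult (null_filiform (n + 1)) x y k) (power_tail k))"
    by (intro sum.cong refl, subst amult_null_filiform_coord) (auto simp: V.scale_sum_left)
  also have "\<dots> = (\<Sum>k\<in>{1..n}. s (amult (null_filiform (n + 1)) x y k) (power_tail k))
      + s (top_coeff x y) (power_tail (n + 1))"
    by simp
  also have "(\<Sum>k\<in>{1..n}. s (amult (null_filiform (n + 1)) x y k) (power_tail k))
      = tail_map (amult M x y)"
    unfolding tail_map_def
    by (intro sum.cong refl arg_cong2[where f = s] amult_null_filiform_truncate) auto
  finally show ?thesis .
qed


section \<open>Non-split Jordan extensions\<close>

text \<open>
  Let \<open>U\<close> be the line (or zero space) through \<open>power_tail (n + 1)\<close> and \<open>W\<close> a complement of it in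
  \<open>V\<close>. All products of \<open>E\<close> lie in \<open>E0\<close>, the graph of \<open>tail_map\<close> thickened by \<open>U\<close>, so \<open>E0\<close> is an ideal
  and \<open>E\<close> is the direct sum of \<open>E0\<close> and the annihilating subspace \<open>W\<close>. Non-splitness forces \<open>W\<close> to
  be zero.
\<close>

lemma non_split_imp_spanned:
  assumes "non_split E"
  shows "\<exists>c. v = s c (power_tail (n + 1))"
proof -
  define U where "U = V.span {power_tail (n + 1)}"
  obtain p where p: "Vector_Spaces.linear s s p" "range p \<subseteq> U" "\<And>u. u \<in> U \<Longrightarrow> p u = u"
    using V.projection_onto_subspace_exists[OF V.subspace_span] unfolding U_def by metis
  interpret p: Vector_Spaces.linear s s p by (rule p(1))
  have pp: "p (p u) = p u" for u
    using p(2,3) by blast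
  define W where "W = {w. p w = 0}"
  define I where "I = {0::nat \<Rightarrow> 'f} \<times> W"
  define E0 where "E0 = {(x, v). x \<in> carrier M \<and> v - tail_map x \<in> U}"
  have U: "V.subspace U" by (simp add: U_def V.subspace_span)
  have cM: "0 \<in> carrier M" "\<And>x y. x \<in> carrier M \<Longrightarrow> y \<in> carrier M \<Longrightarrow> x + y \<in> carrier M"
    "\<And>c x. x \<in> carrier M \<Longrightarrow> scale M c x \<in> carrier M"
    using M.subspace_carrier unfolding M.subspace_def by auto
  have \<theta>0: "\<theta> 0 y = 0" "\<theta> y 0 = 0" "amult M 0 y = 0" "amult M y 0 = 0" if "y \<in> carrier M" for y
    using cocycle_expand[of 0 y] cocycle_expand[of y 0] that cM(1)
    by (auto simp: null_filiform_def fun_eq_iff)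
  have "E.subspace I"
    unfolding E.subspace_def I_def W_def
    by (auto simp: zero_prod_def extension_by_def p.add p.scale null_filiform_def fun_eq_iff)
  moreover have "I \<subseteq> annihilator E"
    by (auto simp: annihilator_def I_def extension_by_def cM \<theta>0 zero_prod_def)
  moreover have "alg_ideal E E0"
    unfolding alg_ideal_def
  proof (intro conjI ballI)
    show "E.subspace E0"
      unfolding E.subspace_def E0_def
      using V.subspace_add[OF U] V.subspace_scale[OF U] V.subspace_0[OF U]
      by (auto simp: zero_prod_def extension_by_def cM tail_map_zero tail_map_add tail_map_scale add_diff_add
          V.scale_right_diff_distrib[symmetric])
    show "E0 \<subseteq> carrier E" by (auto simp: E0_def extension_by_def)
    have prod: "amult E X Y \<in> E0" if "X \<in> carrier E" "Y \<in> carrier E" for X Y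
      using that by (auto simp: E0_def extension_by_def cocycle_decomposition U_def
          M.mult_closed V.span_base V.span_scale)
    fix X Y assume "X \<in> carrier E" "Y \<in> E0"
    with \<open>E0 \<subseteq> carrier E\<close> prod show "amult E X Y \<in> E0" "amult E Y X \<in> E0" by blast+
  qed
  moreover have "direct_sum_of (carrier E) E0 I"
    unfolding direct_sum_of_def
  proof
    show "carrier E = {u + w |u w. u \<in> E0 \<and> w \<in> I}"
    proof (intro subset_antisym subsetI)
      fix X assume "X \<in> carrier E"
      then obtain x v where X: "X = (x, v)" and "x \<in> carrier M"
        by (auto simp: extension_by_def)
      let ?w = "(v - tail_map x) - p (v - tail_map x)"
      have "(x, v - ?w) \<in> E0"
        using \<open>x \<in> carrier M\<close> p(2) by (auto simp: E0_def)
      moreover have "(0, ?w) \<in> I"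
        by (simp add: I_def W_def p.diff pp)
      moreover have "X = (x, v - ?w) + (0, ?w)" by (simp add: X)
      ultimately show "X \<in> {u + w |u w. u \<in> E0 \<and> w \<in> I}" by blast
    next
      fix X assume "X \<in> {u + w |u w. u \<in> E0 \<and> w \<in> I}"
      then obtain u w where "X = u + w" "u \<in> E0" "w \<in> I" by blast
      moreover from this have "u \<in> carrier E" "w \<in> carrier E"
        by (auto simp: E0_def I_def extension_by_def cM)
      ultimately show "X \<in> carrier E"
        using E.subspace_add[OF E.subspace_carrier] by blast
    qed
    show "E0 \<inter> I = {0}"
      using p(3) V.subspace_0[OF U] 
      by (auto simp: E0_def I_def W_def tail_map_zero zero_prod_def cM p.zero)
  qed
  ultimately have "I = {0}"
    using assms unfolding non_split_def by blast
  moreover have "(0, v - p v) \<in> I"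
    by (simp add: I_def W_def p.diff pp)
  ultimately have "v = p v" by (simp add: zero_prod_def)
  then have "v \<in> U" using p(2) by (metis rangeI subsetD)
  then show ?thesis by (auto simp: U_def V.span_singleton)
qed

text \<open>
  The isomorphism writes an element in the basis of powers of \<open>(e\<^sub>1, 0)\<close>: with \<open>\<pi>\<close> the coordinate on
  \<open>V\<close> relative to \<open>power_tail (n + 1)\<close>, the coefficient of the last power in \<open>(x, v)\<close> is
  \<open>\<pi> (v - tail_map x)\<close>. In degree \<open>n + 1\<close> multiplicativity is the decomposition of the cocycle; in
  lower degrees it holds because both products agree with that of $\mu_0^n$.
\<close>

lemma non_split_imp_isomorphic:
  assumes "non_split E" "\<exists>v::'v. v \<noteq> 0"
  shows "alg_isomorphic E (null_filiform (n + 1))"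
proof -
  have nz: "power_tail (n + 1) \<noteq> 0"
    using non_split_imp_spanned[OF assms(1)] assms(2) by (metis V.scale_zero_right)
  define \<pi> where "\<pi> v = (THE c. v = s c (power_tail (n + 1)))" for v
  have \<pi>_eq: "\<pi> (s c (power_tail (n + 1))) = c" for c
    unfolding \<pi>_def using nz by (intro the_equality) auto
  have \<pi>: "s (\<pi> v) (power_tail (n + 1)) = v" for v
    using non_split_imp_spanned[OF assms(1), of v] \<pi>_eq by auto
  have \<pi>_add: "\<pi> (v + w) = \<pi> v + \<pi> w" for v w
    using \<pi>_eq[of "\<pi> v + \<pi> w"] by (simp only: V.scale_left_distrib \<pi>)
  have \<pi>_scale: "\<pi> (s c v) = c * \<pi> v" for c v
    using \<pi>_eq[of "c * \<pi> v"] by (simp only: V.scale_scale[symmetric] \<pi>)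
  define \<phi> where "\<phi> = (\<lambda>(x, v) k. if k = n + 1 then \<pi> (v - tail_map x) else x k)"
  define \<psi> where "\<psi> z = (z(n + 1 := 0), tail_map z + s (z (n + 1)) (power_tail (n + 1)))" for z
  have tail_map_upd: "tail_map (z(n + 1 := c)) = tail_map z" for z c
    unfolding tail_map_def by (intro sum.cong) auto
  have "bij_betw \<phi> (carrier E) (carrier (null_filiform (n + 1)))"
  proof (rule bij_betw_byWitness[where f' = \<psi>])
    show "\<forall>X\<in>carrier E. \<psi> (\<phi> X) = X"
    proof (clarify)
      fix x v assume "(x, v) \<in> carrier E"
      then have x: "(\<phi> (x, v))(n + 1 := 0) = x"
        by (auto simp: \<phi>_def extension_by_def null_filiform_def fun_eq_iff)
      have "tail_map (\<phi> (x, v)) = tail_map x"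
        using tail_map_upd[of "\<phi> (x, v)" 0] by (simp only: x)
      moreover have "\<phi> (x, v) (n + 1) = \<pi> (v - tail_map x)"
        by (simp add: \<phi>_def)
      ultimately show "\<psi> (\<phi> (x, v)) = (x, v)"
        by (simp only: \<psi>_def x \<pi>) simp
    qed
    show "\<forall>z\<in>carrier (null_filiform (n + 1)). \<phi> (\<psi> z) = z"
      using tail_map_upd[of _ 0] by (auto simp: \<phi>_def \<psi>_def fun_eq_iff \<pi>_eq[simplified])
  qed (auto simp: \<phi>_def \<psi>_def extension_by_def null_filiform_def)
  moreover have "\<phi> (X + Y) = \<phi> X + \<phi> Y" for X Y
    by (cases X; cases Y) (auto simp: \<phi>_def fun_eq_iff tail_map_add add_diff_add \<pi>_add)
  moreover have "\<phi> (scale E c X) = scale (null_filiform (n + 1)) c (\<phi> X)" for c X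
    by (cases X) (auto simp: \<phi>_def extension_by_def fun_eq_iff tail_map_scale \<pi>_scale
        V.scale_right_diff_distrib[symmetric], auto simp: null_filiform_def)
  moreover have "\<phi> (amult E X Y) = amult (null_filiform (n + 1)) (\<phi> X) (\<phi> Y)"
    if "X \<in> carrier E" "Y \<in> carrier E" for X Y
  proof
    fix k
    obtain x v y w where XY: "X = (x, v)" "Y = (y, w)" by (metis surj_pair)
    have xy: "x \<in> carrier M" "y \<in> carrier M"
      using that by (auto simp: XY extension_by_def)
    have restrict: "\<phi> X i = x i" "\<phi> Y i = y i" if "i \<in> {1..n}" for i
      using that by (auto simp: \<phi>_def XY)
    consider "k = n + 1" | "k \<in> {1..n}" | "k \<notin> {1..n + 1}" by force
    then show "\<phi> (amult E X Y) k = amult (null_filiform (n + 1)) (\<phi> X) (\<phi> Y) k"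
    proof cases
      case 1
      have "\<phi> (amult E X Y) (n + 1) = top_coeff x y"
        by (simp add: XY \<phi>_def extension_by_def cocycle_decomposition[OF xy] \<pi>_eq[simplified])
      also have "\<dots> = amult (null_filiform (n + 1)) (\<phi> X) (\<phi> Y) (n + 1)"
        using restrict amult_null_filiform_coord[of "n + 1" n x x y y]
          amult_null_filiform_coord[of "n + 1" n "\<phi> X" x "\<phi> Y" y] by simp
      finally show ?thesis using 1 by simp
    next
      case 2
      then show ?thesis
        using amult_null_filiform_truncate[of k n "\<phi> X" x "\<phi> Y" y] restrict
        by (simp add: XY) (simp add: \<phi>_def extension_by_def)
    next
      case 3
      then have "k \<notin> {1..n}" "k \<noteq> n + 1" by auto
      with 3 have "amult (null_filiform n) x y k = 0"
        "amult (null_filiform (n + 1)) (\<phi> X) (\<phi> Y) k = 0"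
        by (blast intro: amult_null_filiform_outside)+
      then show ?thesis
        using \<open>k \<noteq> n + 1\<close> by (simp add: XY) (simp add: \<phi>_def extension_by_def)
    qed
  qed
  ultimately show ?thesis unfolding alg_isomorphic_def by blast
qed

end

theorem theorem4p4:
  fixes n :: nat
    and s :: "'f::field \<Rightarrow> 'v::ab_group_add \<Rightarrow> 'v"
    and E :: "('f, (nat \<Rightarrow> 'f) \<times> 'v) algebra"
  assumes "CHAR('f) \<noteq> 2" and "CHAR('f) \<noteq> 3"
    and "n \<ge> 1"
    and "vector_space s" and "\<exists>v::'v. v \<noteq> 0"
    and "central_extension_in jordan_algebra (null_filiform n) s E"
    and "non_split E"
  shows "alg_isomorphic E (null_filiform (n + 1))"
proof -
  obtain \<theta> where \<theta>: "bilinear_on (carrier (null_filiform n)) (scale (null_filiform n)) s \<theta>"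
    and E: "E = extension_by (null_filiform n) s \<theta>" and "jordan_algebra E"
    using assms(6) unfolding central_extension_in_def by blast
  interpret nf_jordan_cocycle s n \<theta>
    by (intro nf_jordan_cocycle.intro nf_jordan_cocycle_axioms.intro)
      (use assms(1,2,4) \<theta> \<open>jordan_algebra E\<close> in \<open>auto simp: E\<close>)
  show ?thesis using non_split_imp_isomorphic assms(5,7) unfolding E by blast
qed

end
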